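(* Let $\Omega\subset\mathbb{R}^d$ be a domain and let $u$ be the solution of the general linear PDE $$\sum_{i=1}^{k_I}\alpha^I_i(\bm{x})\,\partial_{\bm{x}}^{\bm{\beta}_i}u(\bm{x})=F(\bm{x})\ \text{ in }\Omega,\qquad \sum_{i=1}^{k_B}\alpha^B_i(\bm{x})\,\partial_{\bm{x}}^{\bm{\gamma}_i}u(\bm{x})=G(\bm{x})\ \text{ on }\partial\Omega .$$ Let $p\ge1$ and define $$\hat L_I(\hat u)=\int_\Omega\Big|\sum_{i=1}^{k_I}\alpha^I_i\,\partial_{\bm{x}}^{\bm{\beta}_i}\hat u-F\Big|^p d\bm{x},\qquad \hat L_B(\hat u)=\int_{\partial\Omega}\Big|\sum_{i=1}^{k_B}\alpha^B_i\,\partial_{\bm{x}}^{\bm{\gamma}_i}\hat u-G\Big|^p d\bm{x}_\Gamma,$$ $$M_I(u)=\int_\Omega\Big[\sum_{i=1}^{k_I}\big|\alpha^I_i\,\partial_{\bm{x}}^{\bm{\beta}_i}u\big|\Big]^p d\bm{x},\qquad M_B(u)=\int_{\partial\Omega}\Big[\sum_{i=1}^{k_B}\big|\alpha^B_i\,\partial_{\bm{x}}^{\bm{\gamma}_i}u\big|\Big]^p d\bm{x}_\Gamma,$$ and, for a constant $\lambda\in(0,1)$, the total loss $\hat L(\hat u)=\lambda\hat L_I(\hat u)+(1-\lambda)\hat L_B(\hat u)$. Then: (i) If $\hat u$ is $\epsilon$-close to $u$, then $\hat L_I(\hat u)\le\epsilon^p M_I(u)$ and $\hat L_B(\hat u)\le\epsilon^p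 M_B(u)$. These are necessary, but not sufficient, conditions for $\epsilon$-closeness. Rewritten as a single lower bound on $\epsilon$, they read $$\epsilon\ \ge\ \hat\epsilon:=\Big[\max\Big\{\frac{\hat L_I(\hat u)}{M_I(u)},\frac{\hat L_B(\hat u)}{M_B(u)}\Big\}\Big]^{1/p}.$$ (ii) The quantity $\hat\epsilon$ is bounded from above by $$\hat\epsilon\ \le\ \Big[\max\Big\{\frac{\hat L(\hat u)}{\lambda M_I(u)},\frac{\hat L(\hat u)}{(1-\lambda)M_B(u)}\Big\}\Big]^{1/p}.$$ (iii) Assuming that the value $\hat L(\hat u)$ is held constant as $\lambda$ varies, the optimal choice of $\lambda$ is $$\lambda=\operatorname*{arg\,min}_\lambda\hat\epsilon=\operatorname*{arg\,min}_\lambda\Big[\max\Big\{\frac{1}{\lambda M_I(u)},\frac{1}{(1-\lambda)M_B(u)}\Big\}\Big].$$ The smallest maximum occurs when both terms are equal, i.e. when $\lambda M_I(u)=(1-\lambda)M_B(u)$, whose solution is $$\lambda=\frac{M_B(u)}{M_I(u)+M_B(u)} .$$ That is, for a given loss value $\hat L(\hat u)$, this choice of $\lambda$ results in the smallest $\epsilon$ for which $\hat u$ may be $\epsilon$-close to $u$.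
   Context: For a vector $\bm{\gamma}=(\gamma_1,\dots,\gamma_d)$ of nonnegative integers, $\partial_{\bm{x}}^{\bm{\gamma}}u:=\Big(\prod_{i=1}^d\frac{\partial^{\gamma_i}}{\partial x_i^{\gamma_i}}\Big)u$. The $\bm{\beta}_i,\bm{\gamma}_i$ in the PDE are such vectors; $\alpha^I_i,\alpha^B_i$ are given coefficient functions and $F,G$ are given source functions; $d\bm{x}_\Gamma$ denotes integration over the boundary $\partial\Omega$. The functions $u$ and $\hat u$ (the approximate, or candidate, solution) are scalar functions on $\mathbb{R}^d$. Definition ($\epsilon$-close): a candidate solution $\hat u$ is called $\epsilon$-close to the true solution $u$ if $$\big|\partial_{\bm{x}}^{\bm{\gamma}}u(\bm{x})-\partial_{\bm{x}}^{\bm{\gamma}}\hat u(\bm{x})\big|\le\epsilon\,\big|\partial_{\bm{x}}^{\bm{\gamma}}u(\bm{x})\big|$$ for all $\bm{x}\in\mathbb{R}^d$ and for every vector $\bm{\gamma}$ with entries $\gamma_i\ge0$. *)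

theory Defs
  imports "HOL-Analysis.Analysis"
begin

section \<open>Partial derivatives\<close>

type_synonym 'n point = "(real, 'n) vec"
type_synonym 'n multi_index = "(nat, 'n) vec"

definition partial :: "'n::finite \<Rightarrow> ('n point \<Rightarrow> real) \<Rightarrow> 'n point \<Rightarrow> real" where
  "partial i f x = deriv (\<lambda>t. f (x + t *\<^sub>R axis i 1)) 0"

text \<open>All iterated partial derivatives, of every order and taken in every order of the
  coordinates, exist and are differentiable; this is the class of infinitely differentiable
  functions.\<close>

definition smooth :: "(('n::finite) point \<Rightarrow> real) \<Rightarrow> bool" where
  "smooth f \<longleftrightarrow> (\<forall>is. foldr partial is f differentiable_on UNIV)"

text \<open>The linear order on the index type only fixes the order in which the coordinates of the
  multi-index are processed; the first coordinate is the outermost derivative.\<close>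

definition multi_deriv ::
  "('n::{finite,linorder}) multi_index \<Rightarrow> ('n point \<Rightarrow> real) \<Rightarrow> 'n point \<Rightarrow> real" where
  "multi_deriv \<gamma> f =
     foldr (\<lambda>i. partial i ^^ (\<gamma> $ i)) (sorted_list_of_set (UNIV :: 'n set)) f"

definition eps_close ::
  "real \<Rightarrow> (('n::{finite,linorder}) point \<Rightarrow> real) \<Rightarrow> ('n point \<Rightarrow> real) \<Rightarrow> bool" where
  "eps_close \<epsilon> u v \<longleftrightarrow>
     (\<forall>x \<gamma>. \<bar>multi_deriv \<gamma> u x - multi_deriv \<gamma> v x\<bar> \<le> \<epsilon> * \<bar>multi_deriv \<gamma> u x\<bar>)"


section \<open>Surface measure\<close>

text \<open>The boundary of a domain carries the Hausdorff measure of codimension one, normalised so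
  that it is the usual surface area. The empty set is given weight zero separately, because
  otherwise \<open>0 ^ 0 = 1\<close> would charge it in dimension zero. Covering sets are required to be
  bounded since \<^const>\<open>diameter\<close> is unspecified on unbounded sets.\<close>

definition hausdorff_weight :: "nat \<Rightarrow> 'a::metric_space set \<Rightarrow> ennreal" where
  "hausdorff_weight k U =
     (if U = {} then 0 else ennreal (unit_ball_vol (real k) * (diameter U / 2) ^ k))"

definition hausdorff_covers :: "real \<Rightarrow> 'a::metric_space set \<Rightarrow> (nat \<Rightarrow> 'a set) set" where
  "hausdorff_covers \<delta> A =
     {U. A \<subseteq> (\<Union>i. U i) \<and> (\<forall>i. bounded (U i) \<and> diameter (U i) \<le> \<delta>)}"

definition hausdorff_premeasure :: "nat \<Rightarrow> real \<Rightarrow> 'a::metric_space set \<Rightarrow> ennreal" where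
  "hausdorff_premeasure k \<delta> A = (INF U\<in>hausdorff_covers \<delta> A. \<Sum>i. hausdorff_weight k (U i))"

definition hausdorff_outer :: "nat \<Rightarrow> 'a::metric_space set \<Rightarrow> ennreal" where
  "hausdorff_outer k A = (SUP \<delta>\<in>{0<..}. hausdorff_premeasure k \<delta> A)"

definition hausdorff_measure :: "nat \<Rightarrow> 'a::metric_space measure" where
  "hausdorff_measure k =
     measure_of UNIV (lambda_system UNIV UNIV (hausdorff_outer k)) (hausdorff_outer k)"

lemma hausdorff_premeasure_empty:
  assumes "\<delta> > 0"
  shows "hausdorff_premeasure k \<delta> ({} :: 'a::metric_space set) = 0"
proof -
  have "(\<lambda>_. {}) \<in> hausdorff_covers \<delta> ({} :: 'a set)"
    using assms by (simp add: hausdorff_covers_def diameter_def)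
  then have "hausdorff_premeasure k \<delta> ({} :: 'a set) \<le> (\<Sum>i::nat. hausdorff_weight k ({}::'a set))"
    unfolding hausdorff_premeasure_def by (rule INF_lower)
  then show ?thesis
    by (simp add: hausdorff_weight_def)
qed

lemma hausdorff_premeasure_mono:
  "A \<subseteq> B \<Longrightarrow> hausdorff_premeasure k \<delta> A \<le> hausdorff_premeasure k \<delta> B"
  unfolding hausdorff_premeasure_def hausdorff_covers_def
  by (rule INF_superset_mono) auto

lemma hausdorff_premeasure_subadditive:
  "hausdorff_premeasure k \<delta> (\<Union>n. A n) \<le> (\<Sum>n. hausdorff_premeasure k \<delta> (A n))"
proof (cases "\<forall>n. hausdorff_premeasure k \<delta> (A n) < top")
  case False
  then obtain n where n: "hausdorff_premeasure k \<delta> (A n) = top"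
    using less_top by blast
  have "hausdorff_premeasure k \<delta> (A n) \<le> (\<Sum>n. hausdorff_premeasure k \<delta> (A n))"
    using sum_le_suminf[of "\<lambda>n. hausdorff_premeasure k \<delta> (A n)" "{n}"] by simp
  then show ?thesis
    using n by (simp add: top_unique)
next
  case fin: True
  show ?thesis
  proof (rule ennreal_le_epsilon)
    fix e :: real
    assume e: "0 < e"
    have "\<exists>U\<in>hausdorff_covers \<delta> (A n). (\<Sum>i. hausdorff_weight k (U i))
            \<le> hausdorff_premeasure k \<delta> (A n) + ennreal (e * (1/2) ^ Suc n)" for n
    proof -
      have "hausdorff_premeasure k \<delta> (A n)
          < hausdorff_premeasure k \<delta> (A n) + ennreal (e * (1/2) ^ Suc n)"
        using fin[rule_format, of n] e
        by (cases "hausdorff_premeasure k \<delta> (A n)")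
           (auto simp: ennreal_less_iff simp flip: ennreal_plus)
      then show ?thesis
        unfolding hausdorff_premeasure_def by (auto simp: INF_less_iff intro: less_imp_le)
    qed
    then obtain U where U: "\<And>n. U n \<in> hausdorff_covers \<delta> (A n)"
      and le: "\<And>n. (\<Sum>i. hausdorff_weight k (U n i))
            \<le> hausdorff_premeasure k \<delta> (A n) + ennreal (e * (1/2) ^ Suc n)"
      by metis
    define V where "V m = (case prod_decode m of (n, i) \<Rightarrow> U n i)" for m
    have UV: "U n i = V (prod_encode (n, i))" for n i
      by (simp add: V_def)
    have "V \<in> hausdorff_covers \<delta> (\<Union>n. A n)"
    proof -
      have "(\<Union>n. A n) \<subseteq> (\<Union>m. V m)"
      proof
        fix x assume "x \<in> (\<Union>n. A n)"
        then obtain n where "x \<in> A n" by auto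
        then obtain i where "x \<in> U n i"
          using U[of n] by (auto simp: hausdorff_covers_def)
        then show "x \<in> (\<Union>m. V m)" using UV by auto
      qed
      moreover have "bounded (V m) \<and> diameter (V m) \<le> \<delta>" for m
        using U by (cases "prod_decode m") (auto simp: V_def hausdorff_covers_def)
      ultimately show ?thesis by (auto simp: hausdorff_covers_def)
    qed
    then have "hausdorff_premeasure k \<delta> (\<Union>n. A n) \<le> (\<Sum>m. hausdorff_weight k (V m))"
      unfolding hausdorff_premeasure_def by (rule INF_lower)
    also have "\<dots> = (\<Sum>n. \<Sum>i. hausdorff_weight k (U n i))"
      using suminf_ennreal_2dimen[of "\<lambda>n. \<Sum>i. hausdorff_weight k (U n i)"
          "\<lambda>(n, i). hausdorff_weight k (U n i)"]
      by (simp add: V_def case_prod_beta)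
    also have "\<dots> \<le> (\<Sum>n. hausdorff_premeasure k \<delta> (A n) + ennreal (e * (1/2) ^ Suc n))"
      by (intro suminf_le le) auto
    also have "\<dots> = (\<Sum>n. hausdorff_premeasure k \<delta> (A n)) + (\<Sum>n. ennreal (e * (1/2) ^ Suc n))"
      by (intro suminf_add[symmetric]) auto
    also have "(\<Sum>n. ennreal (e * (1/2) ^ Suc n)) = ennreal e"
      using sums_mult[OF power_half_series, of e] e
      by (subst suminf_ennreal_eq[of _ e]) auto
    finally show "hausdorff_premeasure k \<delta> (\<Union>n. A n)
        \<le> (\<Sum>n. hausdorff_premeasure k \<delta> (A n)) + ennreal e" .
  qed
qed

lemma outer_measure_space_hausdorff_outer:
  "outer_measure_space UNIV (hausdorff_outer k :: 'a::metric_space set \<Rightarrow> ennreal)"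
  unfolding outer_measure_space_def
proof (intro conjI)
  show "positive UNIV (hausdorff_outer k :: 'a set \<Rightarrow> ennreal)"
    by (simp add: positive_def hausdorff_outer_def hausdorff_premeasure_empty)
  show "increasing UNIV (hausdorff_outer k :: 'a set \<Rightarrow> ennreal)"
    unfolding increasing_def hausdorff_outer_def
    by (auto intro!: SUP_mono' hausdorff_premeasure_mono)
  have "hausdorff_outer k (\<Union>n. A n) \<le> (\<Sum>n. hausdorff_outer k (A n))"
    for A :: "nat \<Rightarrow> 'a set"
  proof -
    have "hausdorff_premeasure k \<delta> (\<Union>n. A n) \<le> (\<Sum>n. hausdorff_outer k (A n))"
      if "\<delta> > 0" for \<delta>
    proof -
      have "(\<Sum>n. hausdorff_premeasure k \<delta> (A n)) \<le> (\<Sum>n. hausdorff_outer k (A n))"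
        unfolding hausdorff_outer_def using that by (intro suminf_le SUP_upper) auto
      then show ?thesis
        using hausdorff_premeasure_subadditive order_trans by blast
    qed
    then show ?thesis
      unfolding hausdorff_outer_def[of k "\<Union>n. A n"] by (intro SUP_least) auto
  qed
  then show "countably_subadditive UNIV (hausdorff_outer k :: 'a set \<Rightarrow> ennreal)"
    unfolding countably_subadditive_def by blast
qed

lemma measure_space_hausdorff_outer:
  "measure_space UNIV (lambda_system UNIV UNIV (hausdorff_outer k)) (hausdorff_outer k)"
  using sigma_algebra.caratheodory_lemma[OF sigma_algebra_Pow[of UNIV]]
    outer_measure_space_hausdorff_outer[of k] by simp

lemma space_hausdorff_measure [simp]: "space (hausdorff_measure k) = UNIV"
  by (simp add: hausdorff_measure_def space_measure_of_conv)

lemma sets_hausdorff_measure: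
  "sets (hausdorff_measure k :: 'a::metric_space measure) = lambda_system UNIV UNIV (hausdorff_outer k)"
proof -
  have "sigma_algebra UNIV (lambda_system UNIV UNIV (hausdorff_outer k :: 'a set \<Rightarrow> ennreal))"
    using measure_space_hausdorff_outer by (auto simp: measure_space_def)
  then show ?thesis
    by (simp add: hausdorff_measure_def sigma_algebra.sigma_sets_eq)
qed

lemma emeasure_hausdorff_measure:
  "A \<in> sets (hausdorff_measure k) \<Longrightarrow> emeasure (hausdorff_measure k) A = hausdorff_outer k A"
  unfolding hausdorff_measure_def
  using measure_space_hausdorff_outer[of k] sets_hausdorff_measure[of k]
  by (intro emeasure_measure_of_sigma)
     (auto simp: measure_space_def hausdorff_measure_def)

definition surface_measure :: "('n::finite) point measure" where
  "surface_measure = hausdorff_measure (CARD('n) - 1)"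


section \<open>Linear PDEs and losses\<close>

record ('n::"{finite,linorder}") linear_pde =
  Omega :: "'n point set"
  kI :: nat
  alphaI :: "nat \<Rightarrow> 'n point \<Rightarrow> real"
  betaI :: "nat \<Rightarrow> 'n multi_index"
  sourceF :: "'n point \<Rightarrow> real"
  kB :: nat
  alphaB :: "nat \<Rightarrow> 'n point \<Rightarrow> real"
  gammaB :: "nat \<Rightarrow> 'n multi_index"
  sourceG :: "'n point \<Rightarrow> real"

definition is_domain :: "'a::topological_space set \<Rightarrow> bool" where
  "is_domain S \<longleftrightarrow> open S \<and> connected S \<and> S \<noteq> {}"

definition measurable_coefficients :: "('n::{finite,linorder}) linear_pde \<Rightarrow> bool" where
  "measurable_coefficients P \<longleftrightarrow>
     (\<forall>i\<in>{1..kI P}. set_borel_measurable lebesgue (Omega P) (alphaI P i)) \<and>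
     (\<forall>i\<in>{1..kB P}. set_borel_measurable surface_measure (frontier (Omega P)) (alphaB P i))"

definition op_I :: "('n::{finite,linorder}) linear_pde \<Rightarrow> ('n point \<Rightarrow> real) \<Rightarrow> 'n point \<Rightarrow> real"
  where "op_I P v x = (\<Sum>i=1..kI P. alphaI P i x * multi_deriv (betaI P i) v x)"

definition op_B :: "('n::{finite,linorder}) linear_pde \<Rightarrow> ('n point \<Rightarrow> real) \<Rightarrow> 'n point \<Rightarrow> real"
  where "op_B P v x = (\<Sum>i=1..kB P. alphaB P i x * multi_deriv (gammaB P i) v x)"

definition is_solution :: "('n::{finite,linorder}) linear_pde \<Rightarrow> ('n point \<Rightarrow> real) \<Rightarrow> bool" where
  "is_solution P u \<longleftrightarrow>
     (\<forall>x\<in>Omega P. op_I P u x = sourceF P x) \<and>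
     (\<forall>x\<in>frontier (Omega P). op_B P u x = sourceG P x)"

definition residual_I :: "('n::{finite,linorder}) linear_pde \<Rightarrow> real \<Rightarrow> ('n point \<Rightarrow> real) \<Rightarrow> 'n point \<Rightarrow> real"
  where "residual_I P p v x = \<bar>op_I P v x - sourceF P x\<bar> powr p"

definition residual_B :: "('n::{finite,linorder}) linear_pde \<Rightarrow> real \<Rightarrow> ('n point \<Rightarrow> real) \<Rightarrow> 'n point \<Rightarrow> real"
  where "residual_B P p v x = \<bar>op_B P v x - sourceG P x\<bar> powr p"

definition magnitude_I :: "('n::{finite,linorder}) linear_pde \<Rightarrow> real \<Rightarrow> ('n point \<Rightarrow> real) \<Rightarrow> 'n point \<Rightarrow> real"
  where "magnitude_I P p u x =
    (\<Sum>i=1..kI P. \<bar>alphaI P i x * multi_deriv (betaI P i) u x\<bar>) powr p"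

definition magnitude_B :: "('n::{finite,linorder}) linear_pde \<Rightarrow> real \<Rightarrow> ('n point \<Rightarrow> real) \<Rightarrow> 'n point \<Rightarrow> real"
  where "magnitude_B P p u x =
    (\<Sum>i=1..kB P. \<bar>alphaB P i x * multi_deriv (gammaB P i) u x\<bar>) powr p"

definition L_I :: "('n::{finite,linorder}) linear_pde \<Rightarrow> real \<Rightarrow> ('n point \<Rightarrow> real) \<Rightarrow> real" where
  "L_I P p v = (LINT x:Omega P|lebesgue. residual_I P p v x)"

definition L_B :: "('n::{finite,linorder}) linear_pde \<Rightarrow> real \<Rightarrow> ('n point \<Rightarrow> real) \<Rightarrow> real" where
  "L_B P p v = (LINT x:frontier (Omega P)|surface_measure. residual_B P p v x)"

definition M_I :: "('n::{finite,linorder}) linear_pde \<Rightarrow> real \<Rightarrow> ('n point \<Rightarrow> real) \<Rightarrow> real" where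
  "M_I P p u = (LINT x:Omega P|lebesgue. magnitude_I P p u x)"

definition M_B :: "('n::{finite,linorder}) linear_pde \<Rightarrow> real \<Rightarrow> ('n point \<Rightarrow> real) \<Rightarrow> real" where
  "M_B P p u = (LINT x:frontier (Omega P)|surface_measure. magnitude_B P p u x)"

text \<open>Non-integrable functions have Bochner integral zero, so finiteness of the four integrals
  is expressed by integrability of the integrands.\<close>

definition finite_loss :: "('n::{finite,linorder}) linear_pde \<Rightarrow> real \<Rightarrow> ('n point \<Rightarrow> real) \<Rightarrow> bool" where
  "finite_loss P p v \<longleftrightarrow>
     set_integrable lebesgue (Omega P) (residual_I P p v) \<and>
     set_integrable surface_measure (frontier (Omega P)) (residual_B P p v)"

definition finite_magnitude :: "('n::{finite,linorder}) linear_pde \<Rightarrow> real \<Rightarrow> ('n point \<Rightarrow> real) \<Rightarrow> bool" where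
  "finite_magnitude P p u \<longleftrightarrow>
     set_integrable lebesgue (Omega P) (magnitude_I P p u) \<and>
     set_integrable surface_measure (frontier (Omega P)) (magnitude_B P p u)"

definition pde_setting :: "('n::{finite,linorder}) linear_pde \<Rightarrow> real \<Rightarrow> ('n point \<Rightarrow> real) \<Rightarrow> bool" where
  "pde_setting P p u \<longleftrightarrow>
     is_domain (Omega P) \<and> measurable_coefficients P \<and> smooth u \<and> is_solution P u \<and>
     finite_magnitude P p u"

definition total_loss ::
  "('n::{finite,linorder}) linear_pde \<Rightarrow> real \<Rightarrow> real \<Rightarrow> ('n point \<Rightarrow> real) \<Rightarrow> real" where
  "total_loss P p lam v = lam * L_I P p v + (1 - lam) * L_B P p v"


section \<open>Bounds on epsilon\<close>

text \<open>\<open>eps_val p MI MB LI LB\<close> is the lower bound for epsilon coming from the individual losses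
  \<open>LI\<close> and \<open>LB\<close>; \<open>eps_bound p MI MB ell lam\<close> is its upper bound in terms of the value \<open>ell\<close> of
  the total loss with weight \<open>lam\<close>.\<close>

definition eps_val :: "real \<Rightarrow> real \<Rightarrow> real \<Rightarrow> real \<Rightarrow> real \<Rightarrow> real" where
  "eps_val p MI MB LI LB = (max (LI / MI) (LB / MB)) powr (1 / p)"

definition eps_hat ::
  "('n::{finite,linorder}) linear_pde \<Rightarrow> real \<Rightarrow> ('n point \<Rightarrow> real) \<Rightarrow> ('n point \<Rightarrow> real) \<Rightarrow> real" where
  "eps_hat P p u v = eps_val p (M_I P p u) (M_B P p u) (L_I P p v) (L_B P p v)"

definition eps_bound :: "real \<Rightarrow> real \<Rightarrow> real \<Rightarrow> real \<Rightarrow> real \<Rightarrow> real" where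
  "eps_bound p MI MB ell lam =
     (max (ell / (lam * MI)) (ell / ((1 - lam) * MB))) powr (1 / p)"

text \<open>For a fixed candidate the bound \<^const>\<open>eps_hat\<close> does not depend on \<open>lam\<close> at all. When only
  the value \<open>ell\<close> of the total loss is given, the two partial losses are only known to be
  nonnegative with weighted sum \<open>ell\<close>, and what depends on \<open>lam\<close> is the largest lower bound
  for epsilon compatible with this information.\<close>

definition eps_hat_at_loss :: "real \<Rightarrow> real \<Rightarrow> real \<Rightarrow> real \<Rightarrow> real \<Rightarrow> real" where
  "eps_hat_at_loss p MI MB ell lam =
     Sup {eps_val p MI MB LI LB | LI LB. 0 \<le> LI \<and> 0 \<le> LB \<and> lam * LI + (1 - lam) * LB = ell}"

definition arg_mins :: "(real \<Rightarrow> real) \<Rightarrow> real set" where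
  "arg_mins f = {lam. is_arg_min f (\<lambda>l. 0 < l \<and> l < 1) lam}"

end

(* The residual of v is the differential operator applied to v - u, so closeness bounds it pointwise
   by epsilon times the magnitude of u, and integration gives the losses. Conversely, the losses only
   see the derivatives occurring in the equation: for the equation with the single derivative along
   one coordinate axis on a half-space, adding a constant to the solution does not change them.
   Once the value of the total loss is fixed, the worst distribution of it among the two partial
   losses puts everything into one of them, which gives the bound of (ii); it is minimal where its
   decreasing and its increasing branch meet. *)
theory Submission
  imports Defs
begin

section \<open>Borel sets are Hausdorff measurable\<close>

text \<open>The boundary shapes the proof. The surface measure is the Caratheodory restriction of an
  outer measure, so nothing is known beforehand about its measurable sets. Since a Bochner integral
  of a non-integrable function is 0, an estimate between losses is meaningful only together with
  integrability of the residual. That requires the derivatives, which are continuous, to be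
  measurable for the surface measure, hence Borel sets to be Caratheodory measurable; this follows
  from additivity on sets at positive distance. The counterexample needs in addition a piece of
  boundary of positive and finite surface measure. The half-space is chosen because its boundary
  contains a face of the unit cube, for which crude estimates from both sides suffice; the exact
  area never enters.\<close>

lemma lambda_system_closed:
  fixes \<mu> :: "'a::metric_space set \<Rightarrow> ennreal"
  assumes outer: "outer_measure_space UNIV \<mu>"
    and sep: "\<And>A B d. 0 < d \<Longrightarrow> (\<And>x y. x \<in> A \<Longrightarrow> y \<in> B \<Longrightarrow> d \<le> dist x y) \<Longrightarrow>
                \<mu> A + \<mu> B \<le> \<mu> (A \<union> B)"
    and "closed C"
  shows "C \<in> lambda_system UNIV UNIV \<mu>"
\<comment> \<open>Caratheodory's criterion: the layers \<open>R n\<close> of points of a test set at distance about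
  \<open>1 / n\<close> from \<open>C\<close> are separated from each other if their indices have the same parity, so their
  measures are summable and the part of the test set near \<open>C\<close> is negligible.\<close>
proof -
  have empty: "\<mu> {} = 0" using outer by (auto simp: outer_measure_space_def positive_def)
  have mono: "A \<subseteq> B \<Longrightarrow> \<mu> A \<le> \<mu> B" for A B
    using outer by (auto simp: outer_measure_space_def increasing_def)
  have csub: "\<mu> (\<Union>i. A i) \<le> (\<Sum>i. \<mu> (A i))" for A :: "nat \<Rightarrow> 'a set"
  proof -
    \<comment> \<open>\<open>countably_subadditive\<close> speaks of disjoint families only, hence
      the passage to \<open>disjointed A\<close>.\<close>
    have "\<mu> (\<Union>i. disjointed A i) \<le> (\<Sum>i. \<mu> (disjointed A i))"
      using outer disjoint_family_disjointed[of A]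
      unfolding outer_measure_space_def countably_subadditive_def by blast
    also have "\<dots> \<le> (\<Sum>i. \<mu> (A i))"
      by (intro suminf_le mono disjointed_subset) auto
    finally show ?thesis by (simp add: UN_disjointed_eq)
  qed
  have sub: "\<mu> (A \<union> B) \<le> \<mu> A + \<mu> B" for A B
    using csub[of "binaryset A B"] by (simp add: UN_binaryset_eq suminf_binaryset_eq empty)
  \<comment> \<open>An empty \<open>C\<close> is set apart because \<open>infdist\<close> to the
    empty set is 0 by convention; a test set of infinite measure satisfies the inequality
    trivially.\<close>
  have "\<mu> (T \<inter> C) + \<mu> (T - C) \<le> \<mu> T" if C: "C \<noteq> {}" and fin: "\<mu> T < top" for T
  proof -
    define R where "R n = {x \<in> T. 1 / real (n + 2) \<le> infdist x C \<and> infdist x C < 1 / real (n + 1)}" for n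
    define A where "A n = {x \<in> T. 1 / real (n + 1) \<le> infdist x C}" for n
    have odd_even: "(\<Sum>j<n. \<mu> (R (2 * j + r))) \<le> \<mu> (\<Union>j<n. R (2 * j + r))" for n r
    proof (induction n)
      case (Suc n)
      \<comment> \<open>Earlier layers of the same parity stay at distance at least
        \<open>1 / (2*n + r)\<close> from \<open>C\<close>, while the new one lies below
        \<open>1 / (2*n + r + 1)\<close>; skipping one layer leaves this gap. For
        \<open>n = 0\<close> there is no earlier layer, and with \<open>r = 0\<close> the formula
        would involve \<open>1 / 0 = 0\<close>, so any positive number is taken.\<close>
      define d :: real where "d = (if n = 0 then 1 else 1 / real (2*n + r) - 1 / real (2*n + r + 1))"
      have "0 < d"
        by (simp add: d_def frac_less2)
      moreover have "d \<le> dist x y" if x: "x \<in> (\<Union>j<n. R (2 * j + r))" and y: "y \<in> R (2 * n + r)" for x y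
      proof -
        obtain j where j: "j < n" "1 / real (2 * j + r + 2) \<le> infdist x C"
          using x by (auto simp: R_def)
        have "1 / real (2*n + r) \<le> 1 / real (2 * j + r + 2)"
          using j(1) by (intro divide_left_mono) auto
        moreover have "infdist y C < 1 / real (2*n + r + 1)" using y by (auto simp: R_def)
        moreover have "infdist x C \<le> infdist y C + dist x y" by (rule infdist_triangle)
        ultimately show ?thesis using j unfolding d_def by simp
      qed
      ultimately have "\<mu> (\<Union>j<n. R (2 * j + r)) + \<mu> (R (2 * n + r))
          \<le> \<mu> ((\<Union>j<n. R (2 * j + r)) \<union> R (2 * n + r))"
        by (rule sep)
      moreover have "(\<Union>j<n. R (2 * j + r)) \<union> R (2 * n + r) = (\<Union>j<Suc n. R (2 * j + r))"
        by (auto simp: lessThan_Suc)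
      ultimately have "\<mu> (\<Union>j<n. R (2 * j + r)) + \<mu> (R (2 * n + r)) \<le> \<mu> (\<Union>j<Suc n. R (2 * j + r))"
        by (simp only:)
      then show ?case
        unfolding sum.lessThan_Suc by (rule order_trans[OF add_right_mono[OF Suc.IH]])
    qed simp
    have "(\<Sum>j<n. \<mu> (R j)) \<le> \<mu> T + \<mu> T" for n
    proof -
      have "(\<Sum>j<n. \<mu> (R j)) \<le> (\<Sum>j<2 * n. \<mu> (R j))"
        by (intro sum_mono2) auto
      also have "\<dots> = (\<Sum>j<n. \<mu> (R (2 * j))) + (\<Sum>j<n. \<mu> (R (2 * j + 1)))"
        by (induction n) (auto simp: algebra_simps)
      also have "\<dots> \<le> \<mu> (\<Union>j<n. R (2 * j)) + \<mu> (\<Union>j<n. R (2 * j + 1))"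
        using odd_even[where n = n and r = 0] odd_even[where n = n and r = 1] by (intro add_mono) auto
      also have "\<dots> \<le> \<mu> T + \<mu> T"
        by (intro add_mono mono) (auto simp: R_def)
      finally show ?thesis .
    qed
    then have "(\<Sum>j. \<mu> (R j)) \<le> \<mu> T + \<mu> T"
      by (intro suminf_le_const) auto
    then have finR: "(\<Sum>j. \<mu> (R j)) < top"
      using fin by (auto simp: less_top[symmetric] top_unique)
    \<comment> \<open>Finiteness of the whole sum is essential for the limit 0: in
      \<open>ennreal\<close>, \<open>top - top\<close> is \<open>top\<close>.\<close>
    define tail where "tail n = (\<Sum>j. \<mu> (R j)) - (\<Sum>j<n. \<mu> (R j))" for n
    have "tail \<longlonglongrightarrow> (\<Sum>j. \<mu> (R j)) - (\<Sum>j. \<mu> (R j))"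
      unfolding tail_def using finR by (intro tendsto_diff_ennreal tendsto_const summable_LIMSEQ) auto
    then have tail: "tail \<longlonglongrightarrow> 0"
      using finR by simp
    have "\<mu> (T \<inter> C) + \<mu> (T - C) \<le> \<mu> T + tail n" for n
    proof -
      have "T - C \<subseteq> A n \<union> (\<Union>j. R (j + n))"
      proof
        fix x assume x: "x \<in> T - C"
        then have "infdist x C > 0"
          using infdist_pos_not_in_closed[OF \<open>closed C\<close> C] by auto
        then obtain m where "1 / real (Suc m) < infdist x C"
          by (rule nat_approx_posE)
        then have m: "1 / real (m + 1) \<le> infdist x C" by simp
        \<comment> \<open>Minimality supplies the upper bound \<open>infdist x C < 1 / k\<close>, so
          for \<open>k > n\<close> the point lies in the layer of index \<open>k - 1\<close>, which
          is at least \<open>n\<close>.\<close>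
        define k where "k = (LEAST m. 1 / real (m + 1) \<le> infdist x C)"
        have k: "1 / real (k + 1) \<le> infdist x C" "\<And>j. j < k \<Longrightarrow> infdist x C < 1 / real (j + 1)"
          unfolding k_def by (rule LeastI, rule m) (drule not_less_Least, simp)
        show "x \<in> A n \<union> (\<Union>j. R (j + n))"
        proof (cases "k \<le> n")
          case True
          then have "1 / real (n + 1) \<le> 1 / real (k + 1)" by (intro divide_left_mono) auto
          then show ?thesis using k x by (auto simp: A_def)
        next
          case False
          then have "x \<in> R ((k - 1 - n) + n)"
            using k(1) k(2)[of "k - 1"] x by (simp add: R_def of_nat_diff)
          then show ?thesis by blast
        qed
      qed
      then have "\<mu> (T - C) \<le> \<mu> (A n) + \<mu> (\<Union>j. R (j + n))"
        by (rule order_trans[OF mono sub])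
      also have "\<dots> \<le> \<mu> (A n) + (\<Sum>j. \<mu> (R (j + n)))"
        by (intro add_left_mono csub)
      also have "(\<Sum>j. \<mu> (R (j + n))) = tail n"
      proof -
        have split: "(\<Sum>j. \<mu> (R j)) = (\<Sum>j. \<mu> (R (j + n))) + (\<Sum>j<n. \<mu> (R j))"
          by (intro suminf_offset summableI)
        then have "(\<Sum>j<n. \<mu> (R j)) \<noteq> top"
          using finR by (auto simp: less_top)
        then show ?thesis
          unfolding tail_def split by (rule ennreal_add_diff_cancel_right[symmetric])
      qed
      finally have "\<mu> (T - C) \<le> \<mu> (A n) + tail n" .
      moreover have "\<mu> (T \<inter> C) + \<mu> (A n) \<le> \<mu> ((T \<inter> C) \<union> A n)"
      proof (rule sep)
        fix x y assume "x \<in> T \<inter> C" "y \<in> A n"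
        then show "1 / real (n + 1) \<le> dist x y"
          using infdist_triangle[of y C x] by (simp add: A_def dist_commute)
      qed simp
      moreover have "\<mu> ((T \<inter> C) \<union> A n) \<le> \<mu> T"
        by (rule mono) (auto simp: A_def)
      ultimately have "\<mu> (T \<inter> C) + \<mu> (A n) + tail n \<le> \<mu> T + tail n"
        by (intro add_right_mono) (rule order_trans)
      then show ?thesis
        using add_left_mono[OF \<open>\<mu> (T - C) \<le> \<mu> (A n) + tail n\<close>, of "\<mu> (T \<inter> C)"]
        unfolding add.assoc by (rule order_trans[rotated])
    qed
    moreover have "(\<lambda>n. \<mu> T + tail n) \<longlonglongrightarrow> \<mu> T + 0"
      by (intro tendsto_add tendsto_const tail)
    ultimately show ?thesis
      by (intro LIMSEQ_le_const[of "\<lambda>n. \<mu> T + tail n" "\<mu> T"]) auto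
  qed
  then have "\<mu> (T \<inter> C) + \<mu> (T - C) \<le> \<mu> T" for T
    by (cases "C = {}"; cases "\<mu> T = top") (auto simp: empty less_top)
  moreover have "\<mu> T \<le> \<mu> (T \<inter> C) + \<mu> (T - C)" for T
    using sub[of "T \<inter> C" "T - C"] by (simp add: Int_Diff_Un)
  ultimately have "\<mu> (T \<inter> C) + \<mu> (T - C) = \<mu> T" for T
    by (simp add: antisym)
  moreover have "C \<inter> T = T \<inter> C" "(UNIV - C) \<inter> T = T - C" for T
    by auto
  ultimately show ?thesis
    by (simp add: lambda_system_def)
qed

lemma hausdorff_premeasure_antimono:
  assumes "\<delta> \<le> \<delta>'"
  shows "hausdorff_premeasure k \<delta>' A \<le> hausdorff_premeasure k \<delta> A"
proof -
  have "hausdorff_covers \<delta> A \<subseteq> hausdorff_covers \<delta>' A"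
    using assms order_trans unfolding hausdorff_covers_def by blast
  then show ?thesis
    unfolding hausdorff_premeasure_def by (rule INF_superset_mono) simp
qed

text \<open>A covering set of diameter at most \<open>\<delta> < d\<close> cannot meet both
  \<open>A\<close> and \<open>B\<close>. Replacing the sets that miss \<open>A\<close>, respectively
  \<open>B\<close>, by the empty set, which weighs 0, splits one cover into two without counting any
  set twice.\<close>

lemma hausdorff_premeasure_separated:
  assumes sep: "\<And>x y. x \<in> A \<Longrightarrow> y \<in> B \<Longrightarrow> d \<le> dist x y" and "\<delta> < d" "0 \<le> \<delta>"
  shows "hausdorff_premeasure k \<delta> A + hausdorff_premeasure k \<delta> B \<le> hausdorff_premeasure k \<delta> (A \<union> B)"
  unfolding hausdorff_premeasure_def[of k \<delta> "A \<union> B"]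
proof (rule INF_greatest)
  fix U assume U: "U \<in> hausdorff_covers \<delta> (A \<union> B)"
  define V where "V S i = (if U i \<inter> S = {} then {} else U i)" for S i
  have cover: "V S \<in> hausdorff_covers \<delta> S" if "S \<subseteq> A \<union> B" for S
  proof -
    have "S \<subseteq> (\<Union>i. U i)" "\<And>i. bounded (U i)" "\<And>i. diameter (U i) \<le> \<delta>"
      using U that by (auto simp: hausdorff_covers_def)
    then show ?thesis
      using \<open>0 \<le> \<delta>\<close> by (auto simp: hausdorff_covers_def V_def) blast
  qed
  have "hausdorff_weight k (V A i) + hausdorff_weight k (V B i) \<le> hausdorff_weight k (U i)" for i
  proof -
    have "U i \<inter> A = {} \<or> U i \<inter> B = {}"
    proof (rule ccontr)
      assume "\<not> ?thesis"
      then obtain x y where "x \<in> U i" "x \<in> A" "y \<in> U i" "y \<in> B" by auto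
      moreover have "bounded (U i)" "diameter (U i) \<le> \<delta>"
        using U by (auto simp: hausdorff_covers_def)
      ultimately show False
        using sep[of x y] diameter_bounded_bound[of "U i" x y] \<open>\<delta> < d\<close> by linarith
    qed
    then show ?thesis by (auto simp: V_def hausdorff_weight_def)
  qed
  then have "(\<Sum>i. hausdorff_weight k (V A i)) + (\<Sum>i. hausdorff_weight k (V B i))
      \<le> (\<Sum>i. hausdorff_weight k (U i))"
    by (subst suminf_add) (auto intro!: suminf_le)
  moreover have "hausdorff_premeasure k \<delta> A \<le> (\<Sum>i. hausdorff_weight k (V A i))"
    "hausdorff_premeasure k \<delta> B \<le> (\<Sum>i. hausdorff_weight k (V B i))"
    unfolding hausdorff_premeasure_def by (auto intro!: INF_lower cover)
  ultimately show "hausdorff_premeasure k \<delta> A + hausdorff_premeasure k \<delta> B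
      \<le> (\<Sum>i. hausdorff_weight k (U i))"
    by (meson add_mono order_trans)
qed

lemma hausdorff_outer_separated:
  assumes "0 < d" and sep: "\<And>x y. x \<in> A \<Longrightarrow> y \<in> B \<Longrightarrow> d \<le> dist x y"
  shows "hausdorff_outer k A + hausdorff_outer k B \<le> hausdorff_outer k (A \<union> B)"
proof -
  have "hausdorff_premeasure k \<delta>1 A + hausdorff_premeasure k \<delta>2 B \<le> hausdorff_outer k (A \<union> B)"
    if "0 < \<delta>1" "0 < \<delta>2" for \<delta>1 \<delta>2
  proof -
    \<comment> \<open>The two suprema run over independent scales; refining both to a common one
      below \<open>d\<close> only increases the premeasures.\<close>
    define \<delta> where "\<delta> = min (min \<delta>1 \<delta>2) (d / 2)"
    have \<delta>: "0 < \<delta>" "\<delta> < d" "\<delta> \<le> \<delta>1" "\<delta> \<le> \<delta>2" using that \<open>0 < d\<close> by (auto simp: \<delta>_def)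
    have "hausdorff_premeasure k \<delta>1 A + hausdorff_premeasure k \<delta>2 B
        \<le> hausdorff_premeasure k \<delta> A + hausdorff_premeasure k \<delta> B"
      by (intro add_mono hausdorff_premeasure_antimono \<delta>)
    also have "\<dots> \<le> hausdorff_premeasure k \<delta> (A \<union> B)"
      using \<delta> by (intro hausdorff_premeasure_separated[of A B d] sep) auto
    also have "\<dots> \<le> hausdorff_outer k (A \<union> B)"
      unfolding hausdorff_outer_def using \<delta> by (intro SUP_upper) auto
    finally show ?thesis .
  qed
  then show ?thesis
    unfolding hausdorff_outer_def[of k A] hausdorff_outer_def[of k B]
    by (simp add: ennreal_SUP_add_left[symmetric] ennreal_SUP_add_right SUP_le_iff)
qed

text \<open>This makes continuous functions, in particular the derivatives of smooth ones,
  measurable for the surface measure.\<close>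

lemma borel_subset_sets_hausdorff_measure:
  "sets borel \<subseteq> sets (hausdorff_measure k :: 'a::metric_space measure)"
proof -
  have "C \<in> sets (hausdorff_measure k)" if "closed C" for C :: "'a set"
    unfolding sets_hausdorff_measure
    using outer_measure_space_hausdorff_outer hausdorff_outer_separated that
    by (rule lambda_system_closed)
  then have "Collect closed \<subseteq> sets (hausdorff_measure k :: 'a measure)"
    by auto
  then have "sigma_sets UNIV (Collect closed) \<subseteq> sets (hausdorff_measure k :: 'a measure)"
    using sets.sigma_sets_subset[of _ "hausdorff_measure k :: 'a measure"] by simp
  then show ?thesis by (simp add: borel_eq_closed)
qed

section \<open>Hausdorff measure of a face of the unit cube\<close>

text \<open>Covers are sequences by definition; a finite one is padded with empty sets, which have
  weight 0.\<close>

lemma hausdorff_premeasure_finite_cover: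
  assumes "finite I" "A \<subseteq> (\<Union>a\<in>I. U a)" "0 \<le> \<delta>"
    and U: "\<And>a. a \<in> I \<Longrightarrow> bounded (U a)" "\<And>a. a \<in> I \<Longrightarrow> diameter (U a) \<le> \<delta>"
  shows "hausdorff_premeasure k \<delta> A \<le> (\<Sum>a\<in>I. hausdorff_weight k (U a))"
proof -
  obtain h where h: "bij_betw h {..<card I} I"
    using ex_bij_betw_nat_finite[OF \<open>finite I\<close>] atLeast0LessThan by auto
  define V where "V j = (if j < card I then U (h j) else {})" for j
  have hI: "h j \<in> I" if "j < card I" for j
    using bij_betwE[OF h] that by auto
  have "A \<subseteq> (\<Union>j. V j)"
  proof
    fix x assume "x \<in> A"
    then obtain a where "a \<in> I" "x \<in> U a" using assms by auto
    moreover obtain j where "j < card I" "h j = a"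
      using h \<open>a \<in> I\<close> unfolding bij_betw_def by (metis imageE lessThan_iff)
    ultimately have "x \<in> V j" by (simp add: V_def)
    then show "x \<in> (\<Union>j. V j)" by blast
  qed
  moreover have "bounded (V j) \<and> diameter (V j) \<le> \<delta>" for j
    using U hI \<open>0 \<le> \<delta>\<close> by (simp add: V_def)
  ultimately have "V \<in> hausdorff_covers \<delta> A"
    by (simp add: hausdorff_covers_def)
  then have "hausdorff_premeasure k \<delta> A \<le> (\<Sum>j. hausdorff_weight k (V j))"
    unfolding hausdorff_premeasure_def by (rule INF_lower)
  also have "\<dots> = (\<Sum>j<card I. hausdorff_weight k (V j))"
    by (rule suminf_finite) (auto simp: V_def hausdorff_weight_def)
  also have "\<dots> = (\<Sum>j<card I. hausdorff_weight k (U (h j)))"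
    by (simp add: V_def)
  also have "\<dots> = (\<Sum>a\<in>I. hausdorff_weight k (U a))"
    by (rule sum.reindex_bij_betw[OF h])
  finally show ?thesis .
qed

lemma emeasure_lborel_cbox_cart:
  fixes a b :: "real ^ 'n"
  assumes "\<And>i. a $ i \<le> b $ i"
  shows "emeasure lborel (cbox a b) = ennreal (\<Prod>i\<in>UNIV. b $ i - a $ i)"
proof -
  have "cbox a b \<noteq> {}" using assms by (auto simp: interval_ne_empty_cart)
  then show ?thesis
    using emeasure_eq_ennreal_measure[of lborel "cbox a b"] emeasure_lborel_cbox_finite[of a b]
    by (simp add: content_cbox_cart)
qed

lemma prod_if_eq_card:
  fixes k :: "'n::finite" and c :: "'a::comm_semiring_1"
  shows "(\<Prod>j\<in>UNIV. if j = k then 1 else c) = c ^ (CARD('n) - 1)"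
proof -
  have "(\<Prod>j\<in>UNIV. if j = k then 1 else c) = (\<Prod>j\<in>UNIV - {k}. c)"
    by (subst prod.remove[of _ k]) (auto intro!: prod.cong)
  then show ?thesis by (simp add: card_Diff_singleton)
qed

text \<open>The corner \<open>1 - axis k 1\<close> has k-th coordinate 0 and all others 1, so the
  box is the face of the unit cube in the hyperplane \<open>x $ k = 0\<close>.\<close>

lemma hausdorff_outer_face_pos:
  fixes k :: "'n::finite"
  shows "0 < hausdorff_outer (CARD('n) - 1) (cbox 0 (1 - axis k 1) :: 'n point set)"
proof -
  define d where "d = CARD('n) - 1"
  define Q :: "'n point set" where "Q = cbox 0 (1 - axis k 1)"
  \<comment> \<open>The box around a set of diameter \<open>D\<close> will have sides
    \<open>2 * D\<close> in \<open>d\<close> directions and 1 in the remaining one. The factor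
    \<open>c\<close> turns its volume \<open>(2 * D) ^ d\<close> into exactly the weight
    \<open>unit_ball_vol d * (D / 2) ^ d\<close>.\<close>
  define c where "c = unit_ball_vol (real d) / 4 ^ d"
  have "0 < c" by (simp add: c_def)
  have "ennreal c \<le> (\<Sum>i. hausdorff_weight d (U i))" if U: "U \<in> hausdorff_covers 1 Q" for U
  proof -
    \<comment> \<open>Thickening the covering sets by the unit interval along the axis \<open>k\<close> turns the cover of the
      face into a cover of the unit cube by boxes, whose total volume is at least 1.\<close>
    define z where "z i = (SOME x. x \<in> U i)" for i
    define D where "D i = diameter (U i)" for i
    define B where "B i = (if U i = {} then {} else
      cbox (\<chi> j. if j = k then 0 else z i $ j - D i) (\<chi> j. if j = k then 1 else z i $ j + D i))" for i
    have "0 \<le> D i" for i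
      using U diameter_ge_0[of "U i"] by (auto simp: D_def hausdorff_covers_def)
    have "cbox 0 1 \<subseteq> (\<Union>i. B i)"
    proof
      fix x :: "'n point" assume x: "x \<in> cbox 0 1"
      define y where "y = (\<chi> j. if j = k then 0 else x $ j)"
      have "y \<in> Q"
        using x by (auto simp: y_def Q_def mem_box_cart axis_def)
      then obtain i where y: "y \<in> U i"
        using U by (auto simp: hausdorff_covers_def)
      then have "z i \<in> U i" unfolding z_def by (rule someI)
      then have "dist y (z i) \<le> D i"
        using U y unfolding D_def by (intro diameter_bounded_bound) (auto simp: hausdorff_covers_def)
      then have dist: "\<bar>y $ j - z i $ j\<bar> \<le> D i" for j
        using component_le_norm_cart[of "y - z i" j] by (simp add: dist_norm)
      have "z i $ j - D i \<le> x $ j \<and> x $ j \<le> z i $ j + D i" if "j \<noteq> k" for j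
      proof -
        have "y $ j = x $ j" using that by (simp add: y_def)
        then show ?thesis using dist[of j] by linarith
      qed
      then have "x \<in> B i"
        using y x by (auto simp: B_def mem_box_cart)
      then show "x \<in> (\<Union>i. B i)" by blast
    qed
    then have "emeasure lborel (cbox 0 1 :: 'n point set) \<le> emeasure lborel (\<Union>i. B i)"
      by (intro emeasure_mono) (auto simp: B_def)
    also have "\<dots> \<le> (\<Sum>i. emeasure lborel (B i))"
      by (intro emeasure_subadditive_countably) (auto simp: B_def)
    finally have "1 \<le> (\<Sum>i. emeasure lborel (B i))"
      by (simp add: emeasure_lborel_cbox_cart)
    then have "ennreal c * 1 \<le> ennreal c * (\<Sum>i. emeasure lborel (B i))"
      by (rule mult_left_mono) simp
    also have "\<dots> = (\<Sum>i. ennreal c * emeasure lborel (B i))"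
      by simp
    also have "\<dots> = (\<Sum>i. hausdorff_weight d (U i))"
    proof (rule suminf_cong)
      fix i
      show "ennreal c * emeasure lborel (B i) = hausdorff_weight d (U i)"
      proof (cases "U i = {}")
        case False
        let ?lo = "\<chi> j. if j = k then 0 else z i $ j - D i"
        let ?hi = "\<chi> j. if j = k then 1 else z i $ j + D i"
        have diff: "?hi $ j - ?lo $ j = (if j = k then 1 else 2 * D i)" for j
          by simp
        then have "?lo $ j \<le> ?hi $ j" for j
          using \<open>0 \<le> D i\<close> by simp
        then have "emeasure lborel (cbox ?lo ?hi) = ennreal (\<Prod>j\<in>UNIV. ?hi $ j - ?lo $ j)"
          by (rule emeasure_lborel_cbox_cart)
        then have "emeasure lborel (B i) = ennreal (\<Prod>j\<in>UNIV. if j = k then 1 else 2 * D i)"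
          using False unfolding diff by (simp add: B_def)
        also have "\<dots> = ennreal ((2 * D i) ^ d)"
          unfolding prod_if_eq_card d_def ..
        finally have "ennreal c * emeasure lborel (B i) = ennreal (c * (2 * D i) ^ d)"
          using \<open>0 < c\<close> by (simp add: ennreal_mult')
        also have "c * (2 * D i) ^ d = unit_ball_vol (real d) * (D i / 2) ^ d"
        proof -
          have "(2 * D i) ^ d / 4 ^ d = (D i / 2) ^ d"
            unfolding power_divide[symmetric] by simp
          then show ?thesis by (metis c_def times_divide_eq_left times_divide_eq_right)
        qed
        finally show ?thesis
          using False by (simp add: hausdorff_weight_def D_def)
      qed (simp add: B_def hausdorff_weight_def)
    qed
    finally show ?thesis by simp
  qed
  then have "ennreal c \<le> hausdorff_premeasure d 1 Q"
    unfolding hausdorff_premeasure_def by (rule INF_greatest)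
  also have "\<dots> \<le> hausdorff_outer d Q"
    unfolding hausdorff_outer_def by (intro SUP_upper) auto
  finally show ?thesis
    using \<open>0 < c\<close> unfolding d_def Q_def by (metis ennreal_less_zero_iff less_le_trans)
qed

lemma unit_interval_grid:
  fixes y :: real
  assumes "0 \<le> y" "y \<le> 1" "0 < N"
  obtains j where "j < N" "real j / N \<le> y" "y \<le> (real j + 1) / N"
\<comment> \<open>The right end point belongs to the last cell, whereas the floor of
  \<open>y * N\<close> would give the index \<open>N\<close>, outside the range.\<close>
proof (cases "y = 1")
  case True
  then show ?thesis using assms that[of "N - 1"] by (simp add: of_nat_diff)
next
  case False
  define j where "j = nat \<lfloor>y * N\<rfloor>"
  have "real j \<le> y * N" "y * N < real j + 1"
    using assms by (simp_all add: j_def)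
  moreover have "y * N < N" using False assms by simp
  ultimately have "j < N" by (simp flip: of_nat_less_iff)
  then show ?thesis
    using \<open>real j \<le> y * N\<close> \<open>y * N < real j + 1\<close> assms that[of j] by (simp add: field_simps)
qed

text \<open>A grid divides the face into \<open>N ^ d\<close> cubes of side \<open>1 / N\<close>,
  whose diameter is at most \<open>CARD('n) / N\<close> by the l1 norm. In the sum of the weights
  the powers of \<open>N\<close> cancel, so the bound is the same at every scale.\<close>

lemma hausdorff_outer_face_finite:
  fixes k :: "'n::finite"
  shows "hausdorff_outer (CARD('n) - 1) (cbox 0 (1 - axis k 1) :: 'n point set) < top"
proof -
  define d where "d = CARD('n) - 1"
  define Q :: "'n point set" where "Q = cbox 0 (1 - axis k 1)"
  define c where "c = unit_ball_vol (real d)"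
  have "hausdorff_premeasure d \<delta> Q \<le> ennreal (c * (CARD('n) / 2) ^ d)" if "0 < \<delta>" for \<delta>
  proof -
    obtain N :: nat where "CARD('n) / \<delta> < N" using reals_Archimedean2 by blast
    moreover have "0 < CARD('n) / \<delta>" using \<open>0 < \<delta>\<close> by simp
    ultimately have "0 < real N" by linarith
    then have N: "0 < N" "CARD('n) / N \<le> \<delta>"
      using \<open>0 < \<delta>\<close> \<open>CARD('n) / \<delta> < N\<close> by (simp_all add: field_simps)
    define I where "I = (\<Pi>\<^sub>E i\<in>UNIV - {k}. {..<N})"
    define U :: "('n \<Rightarrow> nat) \<Rightarrow> 'n point set" where
      "U a = cbox (\<chi> i. if i = k then 0 else a i / N) (\<chi> i. if i = k then 0 else (a i + 1) / N)" for a
    have "finite I" unfolding I_def by (intro finite_PiE) auto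
    have "card I = N ^ d"
      by (simp add: I_def card_PiE d_def card_Diff_singleton)
    have diam: "diameter (U a) \<le> CARD('n) / N" for a
    proof (rule diameter_le)
      fix x y assume xy: "x \<in> U a" "y \<in> U a"
      have "\<bar>(x - y) $ i\<bar> \<le> 1 / N" for i
      proof (cases "i = k")
        case True
        then have "x $ i = 0" "y $ i = 0"
          using xy[unfolded U_def mem_box_cart, rule_format, of i] by auto
        then show ?thesis by simp
      next
        case False
        then have "a i / N \<le> x $ i" "x $ i \<le> a i / N + 1 / N" "a i / N \<le> y $ i" "y $ i \<le> a i / N + 1 / N"
          using xy[unfolded U_def mem_box_cart, rule_format, of i] by (simp_all add: add_divide_distrib)
        then show ?thesis
          unfolding vector_minus_component by linarith
      qed
      then have "(\<Sum>i\<in>UNIV. \<bar>(x - y) $ i\<bar>) \<le> CARD('n) * (1 / N)"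
        by (intro sum_bounded_above) auto
      then show "norm (x - y) \<le> CARD('n) / N"
        using norm_le_l1_cart[of "x - y"] by simp
    qed simp
    have "Q \<subseteq> (\<Union>a\<in>I. U a)"
    proof
      fix x assume x: "x \<in> Q"
      have "\<exists>j<N. real j / N \<le> x $ i \<and> x $ i \<le> (real j + 1) / N" if "i \<noteq> k" for i
      proof -
        have "0 \<le> x $ i" "x $ i \<le> 1"
          using x[unfolded Q_def mem_box_cart, rule_format, of i] that by (simp_all add: axis_def)
        then obtain j where "j < N" "real j / N \<le> x $ i" "x $ i \<le> (real j + 1) / N"
          using unit_interval_grid \<open>0 < N\<close> by blast
        then show ?thesis by blast
      qed
      then obtain j where j: "\<And>i. i \<noteq> k \<Longrightarrow> j i < N \<and> real (j i) / N \<le> x $ i \<and> x $ i \<le> (real (j i) + 1) / N"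
        by metis
      have "x $ k = 0"
        using x[unfolded Q_def mem_box_cart, rule_format, of k] by (simp add: axis_def)
      then have "x \<in> U (restrict j (UNIV - {k}))"
        using j by (auto simp: U_def mem_box_cart)
      moreover have "restrict j (UNIV - {k}) \<in> I"
        using j by (auto simp: I_def)
      ultimately show "x \<in> (\<Union>a\<in>I. U a)" by blast
    qed
    then have "hausdorff_premeasure d \<delta> Q \<le> (\<Sum>a\<in>I. hausdorff_weight d (U a))"
      using \<open>finite I\<close> \<open>0 < \<delta>\<close> N order_trans[OF diam]
      by (intro hausdorff_premeasure_finite_cover) (auto simp: U_def)
    also have "\<dots> \<le> (\<Sum>a\<in>I. ennreal (c * (CARD('n) / N / 2) ^ d))"
    proof (rule sum_mono)
      fix a
      have "c * (diameter (U a) / 2) ^ d \<le> c * (CARD('n) / N / 2) ^ d"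
        using diam[of a] diameter_ge_0[of "U a"]
        by (intro mult_left_mono power_mono divide_right_mono) (auto simp: c_def U_def)
      then show "hausdorff_weight d (U a) \<le> ennreal (c * (CARD('n) / N / 2) ^ d)"
        by (simp add: hausdorff_weight_def c_def ennreal_leI)
    qed
    also have "\<dots> = ennreal (real N ^ d * (c * (CARD('n) / N / 2) ^ d))"
      using \<open>card I = N ^ d\<close> by (simp add: ennreal_mult' ennreal_of_nat_eq_real_of_nat)
    also have "real N ^ d * (c * (CARD('n) / N / 2) ^ d) = c * (CARD('n) / 2) ^ d"
      using \<open>0 < N\<close> by (simp add: power_divide)
    finally show ?thesis .
  qed
  then have "hausdorff_outer d Q \<le> ennreal (c * (CARD('n) / 2) ^ d)"
    unfolding hausdorff_outer_def by (auto intro: SUP_least)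
  also have "\<dots> < top" by simp
  finally show ?thesis unfolding d_def Q_def .
qed

section \<open>Smooth functions\<close>

lemma partial_const [simp]: "partial i (\<lambda>x. c) = (\<lambda>x. 0)"
  by (simp add: partial_def fun_eq_iff)

lemma partial_component: "partial i (\<lambda>x. x $ k + c) = (\<lambda>x. if i = k then 1 else 0)"
proof
  fix x :: "(real, 'a) vec"
  have "((\<lambda>t. (x + t *\<^sub>R axis i 1) $ k + c) has_real_derivative (if i = k then 1 else 0)) (at 0)"
    by (auto simp: axis_def intro!: derivative_eq_intros)
  then show "partial i (\<lambda>x. x $ k + c) x = (if i = k then 1 else 0)"
    unfolding partial_def by (rule DERIV_imp_deriv)
qed

lemma smooth_partial: "smooth f \<Longrightarrow> smooth (partial i f)"
  unfolding smooth_def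
proof (intro allI)
  fix ks assume "\<forall>ks. foldr partial ks f differentiable_on UNIV"
  then have "foldr partial (ks @ [i]) f differentiable_on UNIV" by blast
  then show "foldr partial ks (partial i f) differentiable_on UNIV" by simp
qed

lemma smooth_multi_deriv: "smooth f \<Longrightarrow> smooth (multi_deriv \<gamma> f)"
proof -
  assume f: "smooth f"
  have pow: "smooth g \<Longrightarrow> smooth ((partial i ^^ n) g)" for i n and g :: "'a point \<Rightarrow> real"
    by (induction n) (auto intro: smooth_partial)
  have "smooth (foldr (\<lambda>i. partial i ^^ (\<gamma> $ i)) ks f)" for ks
    by (induction ks) (auto intro: f pow)
  then show ?thesis unfolding multi_deriv_def .
qed

lemma smooth_continuous: "smooth f \<Longrightarrow> continuous_on UNIV f"
  unfolding smooth_def by (metis differentiable_imp_continuous_on foldr.simps(1) id_apply)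

lemma smooth_const: "smooth (\<lambda>x. c)"
  unfolding smooth_def
proof
  fix ks :: "'a list"
  have "\<exists>d. foldr partial ks (\<lambda>x. c) = (\<lambda>x. d)"
    by (induction ks) auto
  then show "foldr partial ks (\<lambda>x. c) differentiable_on UNIV" by auto
qed

lemma smooth_component: "smooth (\<lambda>x. x $ k + c)"
  unfolding smooth_def
proof
  fix ks :: "'a list"
  show "foldr partial ks (\<lambda>x. x $ k + c) differentiable_on UNIV"
  \<comment> \<open>\<open>foldr\<close> applies the last entry of the list first. That derivative
    is already constant, so the remaining ones fall under \<open>smooth_const\<close>.\<close>
  proof (cases ks rule: rev_cases)
    case Nil
    have "(\<lambda>x :: 'a point. x $ k + c) differentiable_on UNIV"
      by (intro differentiable_on_add differentiable_on_const linear_imp_differentiable_on)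
         (simp add: linear_iff)
    then show ?thesis using Nil by simp
  next
    case (snoc js i)
    then show ?thesis
      using smooth_const[of 0, where 'a = 'a] smooth_const[of 1, where 'a = 'a] by (simp add: partial_component smooth_def)
  qed
qed

lemma multi_deriv_axis: "multi_deriv (axis k 1) f = partial k f"
proof -
  have "foldr (\<lambda>i. partial i ^^ (axis k 1 $ i)) ks f = (if k \<in> set ks then partial k f else f)"
    if "distinct ks" for ks
    using that by (induction ks) (auto simp: axis_def)
  then show ?thesis by (simp add: multi_deriv_def)
qed

lemma multi_deriv_zero: "multi_deriv 0 f = f"
proof -
  have "foldr (\<lambda>i. partial i ^^ ((0 :: 'a multi_index) $ i)) ks f = f" for ks
    by (induction ks) auto
  then show ?thesis by (simp add: multi_deriv_def)
qed

section \<open>Losses\<close>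

text \<open>Stated for any measure on the whole space that measures Borel sets, so that one proof
  serves both Lebesgue measure on the domain and surface measure on the boundary.\<close>

lemma residual_bound:
  fixes M :: "('n::{finite,linorder}) point measure"
    and \<alpha> :: "nat \<Rightarrow> 'n point \<Rightarrow> real" and \<beta> :: "nat \<Rightarrow> 'n multi_index"
    and u v F :: "'n point \<Rightarrow> real" and k :: nat and p :: real
  defines "op \<equiv> \<lambda>w x. \<Sum>i=1..k. \<alpha> i x * multi_deriv (\<beta> i) w x"
    and "mag \<equiv> \<lambda>x. (\<Sum>i=1..k. \<bar>\<alpha> i x * multi_deriv (\<beta> i) u x\<bar>) powr p"
  assumes borel: "sets borel \<subseteq> sets M" and space: "space M = UNIV"
    and \<alpha>: "\<And>i. i \<in> {1..k} \<Longrightarrow> set_borel_measurable M S (\<alpha> i)"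
    and "smooth u" "smooth v" "eps_close \<epsilon> u v" and "1 \<le> p" "0 \<le> \<epsilon>"
    and sol: "\<And>x. x \<in> S \<Longrightarrow> op u x = F x"
    and int: "set_integrable M S mag"
  shows "set_integrable M S (\<lambda>x. \<bar>op v x - F x\<bar> powr p)"
    and "(LINT x:S|M. \<bar>op v x - F x\<bar> powr p) \<le> \<epsilon> powr p * (LINT x:S|M. mag x)"
proof -
  have meas: "multi_deriv \<gamma> w \<in> borel_measurable M" if "smooth w" for \<gamma> w
  proof -
    have "multi_deriv \<gamma> w \<in> borel_measurable borel"
      using that by (intro borel_measurable_continuous_onI smooth_continuous smooth_multi_deriv)
    then show ?thesis
      using borel space by (auto simp: measurable_def)
  qed
  \<comment> \<open>The source \<open>F\<close> has no measurability assumption of its own, and the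
    coefficients have one only on \<open>S\<close>. Replacing \<open>F\<close> by
    \<open>op u\<close> and moving the indicator into the coefficients leaves only measurable terms;
    off \<open>S\<close> both sides are 0.\<close>
  have eq: "indicator S x *\<^sub>R \<bar>op v x - F x\<bar> powr p
      = \<bar>\<Sum>i=1..k. (indicator S x *\<^sub>R \<alpha> i x) * (multi_deriv (\<beta> i) v x - multi_deriv (\<beta> i) u x)\<bar> powr p" for x
    using sol[of x] \<open>1 \<le> p\<close>
    by (cases "x \<in> S") (auto simp: op_def algebra_simps sum_subtractf)
  have bound: "\<bar>op v x - F x\<bar> powr p \<le> \<epsilon> powr p * mag x" if "x \<in> S" for x
  proof -
    have "\<bar>op v x - F x\<bar> = \<bar>\<Sum>i=1..k. \<alpha> i x * (multi_deriv (\<beta> i) v x - multi_deriv (\<beta> i) u x)\<bar>"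
      using sol[OF that] by (simp add: op_def algebra_simps sum_subtractf flip: sol)
    also have "\<dots> \<le> (\<Sum>i=1..k. \<bar>\<alpha> i x\<bar> * \<bar>multi_deriv (\<beta> i) u x - multi_deriv (\<beta> i) v x\<bar>)"
      by (rule order_trans[OF sum_abs]) (simp add: abs_mult abs_minus_commute)
    also have "\<dots> \<le> (\<Sum>i=1..k. \<bar>\<alpha> i x\<bar> * (\<epsilon> * \<bar>multi_deriv (\<beta> i) u x\<bar>))"
      using \<open>eps_close \<epsilon> u v\<close> by (intro sum_mono mult_left_mono) (auto simp: eps_close_def)
    also have "\<dots> = \<epsilon> * (\<Sum>i=1..k. \<bar>\<alpha> i x * multi_deriv (\<beta> i) u x\<bar>)"
      by (simp add: sum_distrib_left abs_mult mult_ac)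
    finally have "\<bar>op v x - F x\<bar> powr p \<le> (\<epsilon> * (\<Sum>i=1..k. \<bar>\<alpha> i x * multi_deriv (\<beta> i) u x\<bar>)) powr p"
      using \<open>1 \<le> p\<close> by (intro powr_mono2) auto
    then show ?thesis
      using \<open>0 \<le> \<epsilon>\<close> by (simp add: mag_def powr_mult sum_nonneg)
  qed
  have int': "set_integrable M S (\<lambda>x. \<epsilon> powr p * mag x)"
    using int by simp
  show res: "set_integrable M S (\<lambda>x. \<bar>op v x - F x\<bar> powr p)"
    unfolding set_integrable_def
  proof (rule Bochner_Integration.integrable_bound[OF int'[unfolded set_integrable_def]])
    show "(\<lambda>x. indicator S x *\<^sub>R \<bar>op v x - F x\<bar> powr p) \<in> borel_measurable M"
      unfolding eq using \<alpha> meas[OF \<open>smooth u\<close>] meas[OF \<open>smooth v\<close>]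
      by (intro powr_real_measurable borel_measurable_abs borel_measurable_sum
          borel_measurable_times borel_measurable_diff borel_measurable_const)
         (auto simp: set_borel_measurable_def)
    show "AE x in M. norm (indicator S x *\<^sub>R \<bar>op v x - F x\<bar> powr p)
        \<le> norm (indicator S x *\<^sub>R (\<epsilon> powr p * mag x))"
      using bound by (auto simp: indicator_def mag_def)
  qed
  have "(LINT x:S|M. \<bar>op v x - F x\<bar> powr p) \<le> (LINT x:S|M. \<epsilon> powr p * mag x)"
    using res int' bound by (rule set_integral_mono)
  then show "(LINT x:S|M. \<bar>op v x - F x\<bar> powr p) \<le> \<epsilon> powr p * (LINT x:S|M. mag x)"
    by simp
qed

lemma eps_close_losses:
  assumes "1 \<le> p" "pde_setting P p u" "0 \<le> \<epsilon>" "smooth v" "eps_close \<epsilon> u v"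
  shows "finite_loss P p v"
    and "L_I P p v \<le> \<epsilon> powr p * M_I P p u"
    and "L_B P p v \<le> \<epsilon> powr p * M_B P p u"
proof -
  note setting = assms(2)[unfolded pde_setting_def is_solution_def finite_magnitude_def
    measurable_coefficients_def magnitude_I_def[abs_def] magnitude_B_def[abs_def]
    op_I_def op_B_def]
  have borel: "sets borel \<subseteq> sets (surface_measure :: 'a point measure)"
    "space (surface_measure :: 'a point measure) = UNIV"
    unfolding surface_measure_def by (simp_all add: borel_subset_sets_hausdorff_measure)
  have lebesgue: "sets borel \<subseteq> sets (lebesgue :: 'a point measure)"
    "space (lebesgue :: 'a point measure) = UNIV"
    by auto
  note I = residual_bound[OF lebesgue, where S = "Omega P" and F = "sourceF P" and u = u and v = v
      and \<alpha> = "alphaI P" and \<beta> = "betaI P" and k = "kI P" and p = p and \<epsilon> = \<epsilon>]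
  note B = residual_bound[OF borel, where S = "frontier (Omega P)" and F = "sourceG P" and u = u
      and v = v and \<alpha> = "alphaB P" and \<beta> = "gammaB P" and k = "kB P" and p = p and \<epsilon> = \<epsilon>]
  show "finite_loss P p v"
    unfolding finite_loss_def residual_I_def[abs_def] residual_B_def[abs_def] op_I_def op_B_def
    using assms setting by (intro conjI I(1) B(1)) auto
  show "L_I P p v \<le> \<epsilon> powr p * M_I P p u"
    unfolding L_I_def M_I_def residual_I_def magnitude_I_def op_I_def
    using assms setting by (intro I(2)) auto
  show "L_B P p v \<le> \<epsilon> powr p * M_B P p u"
    unfolding L_B_def M_B_def residual_B_def magnitude_B_def op_B_def
    using assms setting by (intro B(2)) auto
qed

lemma loss_nonneg: "0 \<le> L_I P p v" "0 \<le> L_B P p v"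
  unfolding L_I_def L_B_def set_lebesgue_integral_def residual_I_def residual_B_def
  by (auto intro!: integral_nonneg_AE)

lemma set_lebesgue_integral_indicator:
  assumes "A \<in> sets M" "emeasure M A < top" "A \<subseteq> S"
  shows "set_integrable M S (indicator A :: 'a \<Rightarrow> real)"
    and "(LINT x:S|M. indicator A x) = measure M A"
proof -
  have *: "(\<lambda>x. indicator S x *\<^sub>R indicator A x :: real) = indicator A"
    using \<open>A \<subseteq> S\<close> by (auto simp: indicator_def fun_eq_iff)
  show "set_integrable M S (indicator A :: 'a \<Rightarrow> real)"
    using assms unfolding set_integrable_def * by (simp add: top_unique less_top)
  show "(LINT x:S|M. indicator A x) = measure M A"
    using assms sets.sets_into_space[of A M]
    unfolding set_lebesgue_integral_def * by (simp add: Int_absorb2)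
qed

text \<open>The operator \<open>\<partial>\<^sub>k\<close> does not see additive constants, so \<open>x $ k + 1\<close> has no loss, although
  it differs from the solution \<open>x $ k\<close> at a zero of the latter. The cut-off coefficients keep
  the magnitudes finite on the unbounded domain.\<close>

lemma zero_loss_not_eps_close:
  fixes p :: real
  assumes "1 \<le> p"
  obtains Q :: "('n::{finite,linorder}) linear_pde" and w v
  where "pde_setting Q p w" "0 < M_I Q p w" "0 < M_B Q p w" "smooth v" "finite_loss Q p v"
    "L_I Q p v = 0" "L_B Q p v = 0" "\<And>\<epsilon>. \<not> eps_close \<epsilon> w v"
proof -
  fix k :: 'n
  define S where "S = {x :: 'n point. 0 < x $ k}"
  \<comment> \<open>The cube with all coordinates in [1, 2] has volume 1 and stays inside the
    half-space; \<open>B\<close> is the face whose surface measure was estimated above.\<close>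
  define A :: "'n point set" where "A = cbox 1 (1 + 1)"
  define B :: "'n point set" where "B = cbox 0 (1 - axis k 1)"
  define Q :: "'n linear_pde" where
    "Q = \<lparr>Omega = S, kI = 1, alphaI = (\<lambda>_. indicator A), betaI = (\<lambda>_. axis k 1),
      sourceF = indicator A, kB = 1, alphaB = (\<lambda>_. indicator B), gammaB = (\<lambda>_. axis k 1),
      sourceG = indicator B\<rparr>"
  define w v :: "'n point \<Rightarrow> real" where "w = (\<lambda>x. x $ k)" and "v = (\<lambda>x. x $ k + 1)"
  have smooth: "smooth w" "smooth v"
    using smooth_component[of k 0] smooth_component[of k 1] by (auto simp: w_def v_def)
  have deriv: "multi_deriv (axis k 1) w = (\<lambda>x. 1)" "multi_deriv (axis k 1) v = (\<lambda>x. 1)"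
    using partial_component[of k k 0] partial_component[of k k 1]
    by (simp_all only: multi_deriv_axis w_def v_def add_0_right if_True simp_thms)
  have op: "op_I Q w = indicator A" "op_I Q v = indicator A" "op_B Q w = indicator B" "op_B Q v = indicator B"
    by (auto simp: fun_eq_iff op_I_def op_B_def Q_def deriv simp del: One_nat_def)
  have ind: "indicator X x powr p = (indicator X x :: real)" for X and x :: "'n point"
    using \<open>1 \<le> p\<close> by (auto simp: indicator_def)
  have mag: "magnitude_I Q p w = indicator A" "magnitude_B Q p w = indicator B"
    by (auto simp: fun_eq_iff magnitude_I_def magnitude_B_def Q_def deriv ind simp del: One_nat_def)
  have frontier: "frontier S = {x. x $ k = 0}"
    by (auto simp: S_def frontier_def interior_open open_halfspace_component_gt_cart)
  have "convex S"
    using convex_halfspace_gt[of 0 "axis k 1 :: 'n point"] by (simp add: S_def inner_axis')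
  have "open S"
    by (simp add: S_def open_halfspace_component_gt_cart)
  have "A \<subseteq> S" by (auto simp: A_def S_def mem_box_cart dest!: spec[of _ k])
  have "A \<noteq> {}" by (auto simp: A_def interval_ne_empty_cart)
  have "B \<subseteq> frontier S"
    by (auto simp: B_def frontier mem_box_cart axis_def dest!: spec[of _ k])
  have A: "A \<in> sets lebesgue" "emeasure lebesgue A = 1"
    by (simp_all add: A_def emeasure_lborel_cbox_cart)
  have B: "B \<in> sets surface_measure" "0 < emeasure surface_measure B" "emeasure surface_measure B < top"
  proof -
    show B: "B \<in> sets surface_measure"
      using borel_subset_sets_hausdorff_measure unfolding surface_measure_def B_def
      by (metis borel_closed closed_cbox subsetD)
    show "0 < emeasure surface_measure B" "emeasure surface_measure B < top"
      using B hausdorff_outer_face_pos[of k] hausdorff_outer_face_finite[of k]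
      by (simp_all add: surface_measure_def emeasure_hausdorff_measure B_def)
  qed
  have S: "S \<in> sets lebesgue" "frontier S \<in> sets surface_measure"
    using \<open>open S\<close> borel_closed[OF frontier_closed, THEN subsetD[OF borel_subset_sets_hausdorff_measure]]
    unfolding surface_measure_def by auto
  have "is_domain (Omega Q)"
    using \<open>open S\<close> \<open>convex S\<close> \<open>A \<noteq> {}\<close> \<open>A \<subseteq> S\<close> by (auto simp: is_domain_def Q_def convex_connected)
  moreover have "measurable_coefficients Q"
    using A B S by (auto simp: measurable_coefficients_def Q_def set_borel_measurable_def)
  moreover have "is_solution Q w"
    by (simp add: is_solution_def op) (simp add: Q_def)
  moreover have "finite_magnitude Q p w"
    unfolding finite_magnitude_def mag using A B \<open>A \<subseteq> S\<close> \<open>B \<subseteq> frontier S\<close>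
    by (auto simp: Q_def intro!: set_lebesgue_integral_indicator(1))
  ultimately have "pde_setting Q p w"
    using smooth by (simp add: pde_setting_def)
  moreover have "M_I Q p w = measure lebesgue A" "M_B Q p w = measure surface_measure B"
    unfolding M_I_def M_B_def mag using A B \<open>A \<subseteq> S\<close> \<open>B \<subseteq> frontier S\<close>
    by (auto simp: Q_def set_lebesgue_integral_indicator(2))
  then have "0 < M_I Q p w" "0 < M_B Q p w"
    using A B by (simp_all add: measure_def enn2real_positive_iff)
  moreover have res: "residual_I Q p v = (\<lambda>x. 0)" "residual_B Q p v = (\<lambda>x. 0)"
    by (simp_all add: fun_eq_iff residual_I_def residual_B_def op) (simp_all add: Q_def)
  have "finite_loss Q p v" "L_I Q p v = 0" "L_B Q p v = 0"
    by (simp_all add: finite_loss_def L_I_def L_B_def res set_integrable_def set_lebesgue_integral_def)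
  moreover have "\<not> eps_close \<epsilon> w v" for \<epsilon>
  proof
    assume "eps_close \<epsilon> w v"
    then have "\<bar>multi_deriv 0 w 0 - multi_deriv 0 v 0\<bar> \<le> \<epsilon> * \<bar>multi_deriv 0 w 0\<bar>"
      unfolding eps_close_def by blast
    then show False by (simp add: multi_deriv_zero w_def v_def)
  qed
  ultimately show ?thesis
    using that smooth by blast
qed

section \<open>Bounds on epsilon\<close>

text \<open>\<open>is_arg_min\<close> is defined by the absence of a strictly smaller value, so the
  minimisers depend only on the strict order that the function induces on the open unit
  interval.\<close>

lemma arg_mins_strict_mono:
  assumes "\<And>l l'. 0 < l \<Longrightarrow> l < 1 \<Longrightarrow> 0 < l' \<Longrightarrow> l' < 1 \<Longrightarrow> f l < f l' \<longleftrightarrow> g l < g l'"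
  shows "arg_mins f = arg_mins g"
  using assms by (auto simp: arg_mins_def is_arg_min_def)

lemma arg_mins_max_inverse:
  assumes "0 < MI" "0 < MB"
  shows "arg_mins (\<lambda>lam. max (1 / (lam * MI)) (1 / ((1 - lam) * MB))) = {MB / (MI + MB)}"
proof -
  define l0 where "l0 = MB / (MI + MB)"
  define f where "f = (\<lambda>lam. max (1 / (lam * MI)) (1 / ((1 - lam) * MB)))"
  have l0: "0 < l0" "l0 < 1" and eq: "l0 * MI = (1 - l0) * MB"
    using assms by (auto simp: l0_def field_simps)
  \<comment> \<open>At \<open>l0\<close> both branches take the same value, by \<open>eq\<close>. To
    the left the first branch alone exceeds it, to the right the second; strictness gives
    uniqueness.\<close>
  have less: "f l0 < f l" if "0 < l" "l < 1" "l \<noteq> l0" for l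
  proof (cases "l < l0")
    case True
    then have "1 / (l0 * MI) < 1 / (l * MI)"
      using that assms l0 by (intro frac_less2) auto
    then show ?thesis using eq by (auto simp: f_def)
  next
    case False
    then have "1 / ((1 - l0) * MB) < 1 / ((1 - l) * MB)"
      using that assms l0 by (intro frac_less2) auto
    then show ?thesis using eq by (auto simp: f_def)
  qed
  have "arg_mins f = {l0}"
    using l0 less less_asym unfolding arg_mins_def is_arg_min_def
    by (auto dest: less_asym)
  then show ?thesis by (simp add: f_def l0_def)
qed

lemma powr_inverse_le_iff:
  fixes x \<epsilon> p :: real
  assumes "0 \<le> x" "0 \<le> \<epsilon>" "0 < p"
  shows "x powr (1 / p) \<le> \<epsilon> \<longleftrightarrow> x \<le> \<epsilon> powr p"
proof -
  have "x powr (1 / p) \<le> (\<epsilon> powr p) powr (1 / p) \<longleftrightarrow> x \<le> \<epsilon> powr p"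
    using assms powr_mono2[of "1 / p"] powr_less_mono2[of "1 / p"] by (smt (verit) zero_less_divide_1_iff powr_ge_zero)
  then show ?thesis using assms by (simp add: powr_powr)
qed

lemma eps_val_le_iff:
  assumes "0 < p" "0 < MI" "0 < MB" "0 \<le> LI" "0 \<le> LB" "0 \<le> \<epsilon>"
  shows "eps_val p MI MB LI LB \<le> \<epsilon> \<longleftrightarrow> LI \<le> \<epsilon> powr p * MI \<and> LB \<le> \<epsilon> powr p * MB"
proof -
  have "0 \<le> max (LI / MI) (LB / MB)" using assms by (simp add: le_max_iff_disj)
  then show ?thesis
    using assms unfolding eps_val_def by (simp add: powr_inverse_le_iff pos_divide_le_eq)
qed

text \<open>Factoring out \<open>ell\<close> exposes an objective that depends on \<open>lam\<close>
  but not on the loss.\<close>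

lemma eps_bound_eq:
  assumes "0 \<le> ell"
  shows "eps_bound p MI MB ell lam
    = (ell * max (1 / (lam * MI)) (1 / ((1 - lam) * MB))) powr (1 / p)"
  using assms by (simp add: eps_bound_def max_mult_distrib_left)

text \<open>Each weighted partial loss is at most the total, because the other one is
  nonnegative.\<close>

lemma eps_val_le_eps_bound:
  assumes "0 < p" "0 < MI" "0 < MB" "0 < lam" "lam < 1" "0 \<le> LI" "0 \<le> LB"
  shows "eps_val p MI MB LI LB \<le> eps_bound p MI MB (lam * LI + (1 - lam) * LB) lam"
proof -
  have "LI / MI \<le> (lam * LI + (1 - lam) * LB) / (lam * MI)"
    "LB / MB \<le> (lam * LI + (1 - lam) * LB) / ((1 - lam) * MB)"
    using assms by (simp_all add: field_simps mult_left_le)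
  then have "max (LI / MI) (LB / MB) \<le> max ((lam * LI + (1 - lam) * LB) / (lam * MI))
      ((lam * LI + (1 - lam) * LB) / ((1 - lam) * MB))"
    by (rule max.mono)
  then show ?thesis
    unfolding eps_val_def eps_bound_def
    using assms by (intro powr_mono2) (auto simp: le_max_iff_disj)
qed

lemma eps_hat_at_loss_eq:
  assumes "0 < p" "0 < MI" "0 < MB" "0 < lam" "lam < 1" "0 \<le> ell"
  shows "eps_hat_at_loss p MI MB ell lam = eps_bound p MI MB ell lam"
proof -
  define E where
    "E = {eps_val p MI MB LI LB | LI LB. 0 \<le> LI \<and> 0 \<le> LB \<and> lam * LI + (1 - lam) * LB = ell}"
  have "e \<le> eps_bound p MI MB ell lam" if "e \<in> E" for e
    using that eps_val_le_eps_bound assms by (auto simp: E_def)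
  moreover have "eps_bound p MI MB ell lam \<in> E"
  proof -
    have *: "max (ell / (lam * MI)) 0 = ell / (lam * MI)"
      "max 0 (ell / ((1 - lam) * MB)) = ell / ((1 - lam) * MB)"
      using assms by (simp_all add: max_absorb1 max_absorb2)
    have "eps_val p MI MB (ell / lam) 0 \<in> E"
      unfolding E_def using assms by (intro CollectI exI[of _ "ell / lam"] exI[of _ 0]) auto
    moreover have "eps_val p MI MB 0 (ell / (1 - lam)) \<in> E"
      unfolding E_def using assms by (intro CollectI exI[of _ 0] exI[of _ "ell / (1 - lam)"]) auto
    \<comment> \<open>The larger of the two terms in the bound decides which extreme distribution
      attains it, so the supremum is a maximum.\<close>
    moreover have "eps_bound p MI MB ell lam \<in> {eps_val p MI MB (ell / lam) 0, eps_val p MI MB 0 (ell / (1 - lam))}"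
      unfolding eps_val_def eps_bound_def
      by (simp add: * max_def[of "ell / (lam * MI)" "ell / ((1 - lam) * MB)"])
    ultimately show ?thesis by auto
  qed
  ultimately have "Sup E = eps_bound p MI MB ell lam"
    by (intro cSup_eq_maximum)
  then show ?thesis by (simp add: eps_hat_at_loss_def E_def)
qed

text \<open>For \<open>ell > 0\<close> the bound is a strictly increasing function of the objective.
  For \<open>ell = 0\<close> it would vanish identically and every \<open>lam\<close> would be a
  minimiser.\<close>

lemma arg_mins_eps_bound:
  assumes "0 < p" "0 < MI" "0 < MB" "0 < ell"
  shows "arg_mins (eps_bound p MI MB ell)
    = arg_mins (\<lambda>lam. max (1 / (lam * MI)) (1 / ((1 - lam) * MB)))"
proof (rule arg_mins_strict_mono)
  fix l l' :: real
  assume l: "0 < l" "l < 1" "0 < l'" "l' < 1"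
  have "x powr (1 / p) < y powr (1 / p) \<longleftrightarrow> x < y" if "0 \<le> x" "0 \<le> y" for x y
    using that assms powr_inverse_le_iff[of y "x powr (1 / p)" p] by (auto simp: powr_powr not_le[symmetric])
  moreover have "0 \<le> ell * max (1 / (l * MI)) (1 / ((1 - l) * MB))" if "0 < l" "l < 1" for l
    using assms that by (simp add: le_max_iff_disj)
  ultimately show "eps_bound p MI MB ell l < eps_bound p MI MB ell l' \<longleftrightarrow>
      max (1 / (l * MI)) (1 / ((1 - l) * MB)) < max (1 / (l' * MI)) (1 / ((1 - l') * MB))"
    using assms l by (simp add: eps_bound_eq)
qed

text \<open>Non-sufficiency is witnessed by an equation \<open>Q\<close> rather than claimed for
  \<open>P\<close>, since for some equations closeness does follow: if the operator is
  \<open>u\<close> itself on the whole space and the solution is 0, loss 0 forces the candidate to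
  be 0.\<close>

theorem mainTheorem3:
  fixes P :: "('n::{finite,linorder}) linear_pde"
    and u :: "'n point \<Rightarrow> real"
    and p :: real
  assumes p: "1 \<le> p"
    and setting: "pde_setting P p u"
  shows
    \<comment> \<open>(i): the bounds are necessary\<close>
    "(\<forall>\<epsilon> v. 0 \<le> \<epsilon> \<longrightarrow> smooth v \<longrightarrow> eps_close \<epsilon> u v \<longrightarrow>
        finite_loss P p v \<and>
        L_I P p v \<le> \<epsilon> powr p * M_I P p u \<and>
        L_B P p v \<le> \<epsilon> powr p * M_B P p u)
     \<and>
     \<comment> \<open>(i): the bounds are not sufficient\<close>
     (\<forall>\<epsilon>\<ge>0. \<exists>(Q :: 'n linear_pde) w v.
        pde_setting Q p w \<and> 0 < M_I Q p w \<and> 0 < M_B Q p w \<and>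
        smooth v \<and> finite_loss Q p v \<and>
        L_I Q p v \<le> \<epsilon> powr p * M_I Q p w \<and>
        L_B Q p v \<le> \<epsilon> powr p * M_B Q p w \<and>
        \<not> eps_close \<epsilon> w v)
     \<and>
     (0 < M_I P p u \<longrightarrow> 0 < M_B P p u \<longrightarrow>
       \<comment> \<open>(i): the bounds rewritten as a lower bound on epsilon\<close>
       (\<forall>\<epsilon> v. 0 \<le> \<epsilon> \<longrightarrow> smooth v \<longrightarrow> finite_loss P p v \<longrightarrow>
          (L_I P p v \<le> \<epsilon> powr p * M_I P p u \<and> L_B P p v \<le> \<epsilon> powr p * M_B P p u
             \<longleftrightarrow> eps_hat P p u v \<le> \<epsilon>))
       \<and>
       \<comment> \<open>(ii)\<close>
       (\<forall>lam v. 0 < lam \<longrightarrow> lam < 1 \<longrightarrow> smooth v \<longrightarrow> finite_loss P p v \<longrightarrow>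
          eps_hat P p u v \<le> eps_bound p (M_I P p u) (M_B P p u) (total_loss P p lam v) lam)
       \<and>
       \<comment> \<open>(iii): the value \<open>ell\<close> of the total loss is held constant while \<open>lam\<close> varies\<close>
       (\<forall>ell>0.
          (\<forall>lam v. 0 < lam \<longrightarrow> lam < 1 \<longrightarrow> smooth v \<longrightarrow> finite_loss P p v \<longrightarrow>
             total_loss P p lam v = ell \<longrightarrow>
             eps_hat P p u v \<le> eps_hat_at_loss p (M_I P p u) (M_B P p u) ell lam) \<and>
          arg_mins (eps_hat_at_loss p (M_I P p u) (M_B P p u) ell) =
          arg_mins (\<lambda>lam. max (1 / (lam * M_I P p u)) (1 / ((1 - lam) * M_B P p u))) \<and>
          arg_mins (eps_bound p (M_I P p u) (M_B P p u) ell) =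
          arg_mins (\<lambda>lam. max (1 / (lam * M_I P p u)) (1 / ((1 - lam) * M_B P p u))))
       \<and>
       arg_mins (\<lambda>lam. max (1 / (lam * M_I P p u)) (1 / ((1 - lam) * M_B P p u))) =
         {M_B P p u / (M_I P p u + M_B P p u)}
       \<and>
       (\<forall>lam. 0 < lam \<longrightarrow> lam < 1 \<longrightarrow>
          (lam \<in> arg_mins (\<lambda>lam. max (1 / (lam * M_I P p u)) (1 / ((1 - lam) * M_B P p u)))
             \<longleftrightarrow> 1 / (lam * M_I P p u) = 1 / ((1 - lam) * M_B P p u)) \<and>
          (1 / (lam * M_I P p u) = 1 / ((1 - lam) * M_B P p u)
             \<longleftrightarrow> lam * M_I P p u = (1 - lam) * M_B P p u) \<and>
          (lam * M_I P p u = (1 - lam) * M_B P p u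
             \<longleftrightarrow> lam = M_B P p u / (M_I P p u + M_B P p u))))"
proof (intro conjI impI)
  let ?MI = "M_I P p u" and ?MB = "M_B P p u"
  let ?obj = "\<lambda>lam. max (1 / (lam * ?MI)) (1 / ((1 - lam) * ?MB))"
  have "0 < p" using p by simp
  show "\<forall>\<epsilon> v. 0 \<le> \<epsilon> \<longrightarrow> smooth v \<longrightarrow> eps_close \<epsilon> u v \<longrightarrow> finite_loss P p v \<and>
      L_I P p v \<le> \<epsilon> powr p * ?MI \<and> L_B P p v \<le> \<epsilon> powr p * ?MB"
    using eps_close_losses[OF p setting] by blast
  show "\<forall>\<epsilon>\<ge>0. \<exists>(Q :: 'n linear_pde) w v. pde_setting Q p w \<and> 0 < M_I Q p w \<and> 0 < M_B Q p w \<and>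
      smooth v \<and> finite_loss Q p v \<and> L_I Q p v \<le> \<epsilon> powr p * M_I Q p w \<and>
      L_B Q p v \<le> \<epsilon> powr p * M_B Q p w \<and> \<not> eps_close \<epsilon> w v"
  proof (intro allI impI)
    fix \<epsilon> :: real
    \<comment> \<open>Vanishing losses meet the bounds for every \<open>\<epsilon>\<close>, so a
      single example refutes sufficiency at all tolerances.\<close>
    obtain Q :: "'n linear_pde" and w v
      where Q: "pde_setting Q p w" "0 < M_I Q p w" "0 < M_B Q p w" "smooth v" "finite_loss Q p v"
        "L_I Q p v = 0" "L_B Q p v = 0" "\<not> eps_close \<epsilon> w v"
      using zero_loss_not_eps_close[OF p] by metis
    then have "L_I Q p v \<le> \<epsilon> powr p * M_I Q p w" "L_B Q p v \<le> \<epsilon> powr p * M_B Q p w"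
      by simp_all
    with Q show "\<exists>(Q :: 'n linear_pde) w v. pde_setting Q p w \<and> 0 < M_I Q p w \<and> 0 < M_B Q p w \<and>
        smooth v \<and> finite_loss Q p v \<and> L_I Q p v \<le> \<epsilon> powr p * M_I Q p w \<and>
        L_B Q p v \<le> \<epsilon> powr p * M_B Q p w \<and> \<not> eps_close \<epsilon> w v"
      by blast
  qed
  assume M: "0 < ?MI" "0 < ?MB"
  note arg_mins_obj = arg_mins_max_inverse[OF M]
  have bound: "eps_hat P p u v \<le> eps_bound p ?MI ?MB (total_loss P p lam v) lam"
    if "0 < lam" "lam < 1" for lam v
    unfolding eps_hat_def total_loss_def
    using \<open>0 < p\<close> M that loss_nonneg by (rule eps_val_le_eps_bound)
  show "\<forall>\<epsilon> v. 0 \<le> \<epsilon> \<longrightarrow> smooth v \<longrightarrow> finite_loss P p v \<longrightarrow>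
      (L_I P p v \<le> \<epsilon> powr p * ?MI \<and> L_B P p v \<le> \<epsilon> powr p * ?MB \<longleftrightarrow> eps_hat P p u v \<le> \<epsilon>)"
    unfolding eps_hat_def using eps_val_le_iff[OF \<open>0 < p\<close> M loss_nonneg] by blast
  show "\<forall>lam v. 0 < lam \<longrightarrow> lam < 1 \<longrightarrow> smooth v \<longrightarrow> finite_loss P p v \<longrightarrow>
      eps_hat P p u v \<le> eps_bound p ?MI ?MB (total_loss P p lam v) lam"
    using bound by blast
  show "\<forall>ell>0. (\<forall>lam v. 0 < lam \<longrightarrow> lam < 1 \<longrightarrow> smooth v \<longrightarrow> finite_loss P p v \<longrightarrow>
        total_loss P p lam v = ell \<longrightarrow> eps_hat P p u v \<le> eps_hat_at_loss p ?MI ?MB ell lam) \<and>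
      arg_mins (eps_hat_at_loss p ?MI ?MB ell) = arg_mins ?obj \<and>
      arg_mins (eps_bound p ?MI ?MB ell) = arg_mins ?obj"
  proof (intro allI impI conjI)
    fix ell :: real assume "0 < ell"
    have eq: "eps_hat_at_loss p ?MI ?MB ell lam = eps_bound p ?MI ?MB ell lam"
      if "0 < lam" "lam < 1" for lam
      using \<open>0 < p\<close> M that \<open>0 < ell\<close> by (intro eps_hat_at_loss_eq) auto
    show "eps_hat P p u v \<le> eps_hat_at_loss p ?MI ?MB ell lam"
      if "0 < lam" "lam < 1" "total_loss P p lam v = ell" for lam v
      using bound[of lam v] eq that by simp
    show bnd: "arg_mins (eps_bound p ?MI ?MB ell) = arg_mins ?obj"
      using \<open>0 < p\<close> M \<open>0 < ell\<close> by (rule arg_mins_eps_bound)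
    \<comment> \<open>The two functions are known to agree only for weights strictly between 0 and
      1, which are the only ones that \<open>arg_mins\<close> compares.\<close>
    have "arg_mins (eps_hat_at_loss p ?MI ?MB ell) = arg_mins (eps_bound p ?MI ?MB ell)"
      by (rule arg_mins_strict_mono) (simp add: eq)
    then show "arg_mins (eps_hat_at_loss p ?MI ?MB ell) = arg_mins ?obj"
      unfolding bnd .
  qed
  show "arg_mins ?obj = {?MB / (?MI + ?MB)}"
    by (rule arg_mins_obj)
  show "\<forall>lam. 0 < lam \<longrightarrow> lam < 1 \<longrightarrow>
      (lam \<in> arg_mins ?obj \<longleftrightarrow> 1 / (lam * ?MI) = 1 / ((1 - lam) * ?MB)) \<and>
      (1 / (lam * ?MI) = 1 / ((1 - lam) * ?MB) \<longleftrightarrow> lam * ?MI = (1 - lam) * ?MB) \<and>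
      (lam * ?MI = (1 - lam) * ?MB \<longleftrightarrow> lam = ?MB / (?MI + ?MB))"
  proof (intro allI impI)
    fix lam :: real
    have "1 / (lam * ?MI) = 1 / ((1 - lam) * ?MB) \<longleftrightarrow> lam * ?MI = (1 - lam) * ?MB"
      by (simp only: inverse_eq_iff_eq flip: inverse_eq_divide)
    moreover have "lam * ?MI = (1 - lam) * ?MB \<longleftrightarrow> lam = ?MB / (?MI + ?MB)"
      using M by (auto simp: field_simps)
    ultimately show "(lam \<in> arg_mins ?obj \<longleftrightarrow> 1 / (lam * ?MI) = 1 / ((1 - lam) * ?MB)) \<and>
        (1 / (lam * ?MI) = 1 / ((1 - lam) * ?MB) \<longleftrightarrow> lam * ?MI = (1 - lam) * ?MB) \<and>
        (lam * ?MI = (1 - lam) * ?MB \<longleftrightarrow> lam = ?MB / (?MI + ?MB))"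
      unfolding arg_mins_obj by simp
  qed
qed

end
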